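(* Let $\mathcal{S}_1=\{|\psi_1\rangle,|\psi_2\rangle,|\psi_3\rangle,|\psi_4\rangle\}\subset\mathbb{C}^2\otimes\mathbb{C}^4$ be the set of mutually orthogonal states (given up to normalization) shared by Alice ($\mathbb{C}^2$) and Bob ($\mathbb{C}^4$), where $$|\psi_1\rangle=|0\mathbf{0}\rangle+|0\mathbf{2}\rangle+|1\mathbf{1}\rangle-|1\mathbf{3}\rangle,\qquad |\psi_2\rangle=|0\mathbf{0}\rangle-|0\mathbf{2}\rangle-|1\mathbf{1}\rangle-|1\mathbf{3}\rangle,$$ $$|\psi_3\rangle=|0\mathbf{1}\rangle-|1\mathbf{2}\rangle-|1\mathbf{0}\rangle-|0\mathbf{3}\rangle,\qquad |\psi_4\rangle=|0\mathbf{1}\rangle-|1\mathbf{2}\rangle+|1\mathbf{0}\rangle+|0\mathbf{3}\rangle,$$ and $\{|0\rangle,|1\rangle\}$, $\{|\mathbf{0}\rangle,|\mathbf{1}\rangle,|\mathbf{2}\rangle,|\mathbf{3}\rangle\}$ are the standard bases of $\mathbb{C}^2$ and $\mathbb{C}^4$. Then $\mathcal{S}_1$ can be deterministically converted to a locally unmarkable set of states via a local orthogonality preserving measurement (OPM).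
   Context: All states are understood up to normalization. LOCC: protocols in which spatially separated parties perform local quantum operations on their own systems and exchange classical messages. Locally (un)markable: for a set of $m$ mutually orthogonal states $\{|\chi_1\rangle,\dots,|\chi_m\rangle\}$, suppose the parties share all $m$ states in an unknown order, i.e. they share $|\chi_{\pi(1)}\rangle\otimes\cdots\otimes|\chi_{\pi(m)}\rangle$ for an unknown permutation $\pi$ of $\{1,\dots,m\}$, each party holding its share of all $m$ states. The set is locally markable if some LOCC protocol identifies $\pi$ with certainty; otherwise it is locally unmarkable. Local OPM: a measurement $\{M_a\}$ (one operator $M_a$ per outcome, $\sum_a M_a^\dagger M_a=\mathbb{I}$) performed by one party on its own system such that, for each outcome, the (nonzero) post-measurement states of the set are mutually orthogonal. "Deterministically converted via a local OPM to a set with a property": there is a local OPM such that, for every outcome, the set of nonzero post-measurement states has that property. *)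

theory Defs
  imports
    Complex_Main
    "Jordan_Normal_Form.Schur_Decomposition"
    "HOL-Combinatorics.Permutations"
begin

section \<open>Bipartite pure states\<close>

text \<open>
  A vector of \<open>\<complex>\<^sup>m \<otimes> \<complex>\<^sup>n\<close> is given by its \<open>m \<times> n\<close> matrix of coefficients: the entry
  \<open>(i, j)\<close> is the coefficient of \<open>|i\<rangle> \<otimes> |j\<rangle>\<close>. Alice holds the first (row) factor and Bob the
  second (column) factor. Under this identification \<open>(K \<otimes> L) \<psi>\<close> is \<open>K \<psi> L\<^sup>T\<close>.
  Vectors are not normalized.
\<close>

definition tensor_vec :: "complex vec \<Rightarrow> complex vec \<Rightarrow> complex mat" where
  "tensor_vec u v = mat (dim_vec u) (dim_vec v) (\<lambda>(i, j). u $ i * v $ j)"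

definition braket :: "complex mat \<Rightarrow> complex mat \<Rightarrow> complex" where
  "braket \<phi> \<psi> = (\<Sum>i<dim_row \<phi>. \<Sum>j<dim_col \<phi>. cnj (\<phi> $$ (i, j)) * \<psi> $$ (i, j))"

definition sqnorm :: "complex mat \<Rightarrow> real" where
  "sqnorm \<psi> = Re (braket \<psi> \<psi>)"

definition mutually_orthogonal :: "complex mat list \<Rightarrow> bool" where
  "mutually_orthogonal \<chi>s \<longleftrightarrow>
     (\<forall>i<length \<chi>s. \<forall>j<length \<chi>s. i \<noteq> j \<longrightarrow> braket (\<chi>s ! i) (\<chi>s ! j) = 0)"

datatype party = Alice | Bob

primrec local_op :: "party \<Rightarrow> complex mat \<Rightarrow> complex mat \<Rightarrow> complex mat" where
  "local_op Alice K \<psi> = K * \<psi>"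
| "local_op Bob K \<psi> = \<psi> * transpose_mat K"

definition kraus_complete :: "nat \<Rightarrow> complex mat list \<Rightarrow> bool" where
  "kraus_complete d Ks \<longleftrightarrow>
     foldr (\<lambda>K S. mat_adjoint K * K + S) Ks (0\<^sub>m d d) = 1\<^sub>m d"

text \<open>
  The tensor product of two bipartite states, regrouped so that Alice holds both first factors
  and Bob both second factors. On coefficient matrices this is the Kronecker product.
\<close>

definition kron :: "complex mat \<Rightarrow> complex mat \<Rightarrow> complex mat" where
  "kron A B = mat (dim_row A * dim_row B) (dim_col A * dim_col B)
     (\<lambda>(i, j). A $$ (i div dim_row B, j div dim_col B) * B $$ (i mod dim_row B, j mod dim_col B))"

definition kron_list :: "complex mat list \<Rightarrow> complex mat" where
  "kron_list \<chi>s = foldr kron \<chi>s (1\<^sub>m 1)"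


section \<open>LOCC protocols\<close>

text \<open>
  In a round, one party applies a quantum instrument to its own system and announces the outcome;
  the rest of the protocol depends on that outcome. Each outcome is a completely positive map,
  given by a finite list of Kraus operators, which may change the dimension of the party's system
  (so ancillas, discarded subsystems and privately kept records are covered). The type is
  coinductive, so the number of rounds need not be bounded.
\<close>

codatatype 'r locc =
    Output 'r
  | Round party "(complex mat list \<times> 'r locc) list"

coinductive valid_locc :: "nat \<Rightarrow> nat \<Rightarrow> 'r locc \<Rightarrow> bool" where
  valid_Output: "valid_locc dA dB (Output r)"
| valid_Alice: "valid_locc dA dB (Round Alice bs)"
    if "kraus_complete dA (concat (map fst bs))"
      and "\<forall>(Ks, P) \<in> set bs. \<exists>d. (\<forall>K \<in> set Ks. K \<in> carrier_mat d dA) \<and> valid_locc d dB P"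
| valid_Bob: "valid_locc dA dB (Round Bob bs)"
    if "kraus_complete dB (concat (map fst bs))"
      and "\<forall>(Ks, P) \<in> set bs. \<exists>d. (\<forall>K \<in> set Ks. K \<in> carrier_mat d dB) \<and> valid_locc dA d P"

text \<open>
  The total weight (squared norm) of the branches of an unnormalized pure state on which the
  protocol outputs \<open>r\<close> after at most \<open>n\<close> rounds. Summing over the Kraus operators of an outcome
  computes the trace of its completely positive map.
\<close>

primrec output_weight :: "nat \<Rightarrow> 'r \<Rightarrow> 'r locc \<Rightarrow> complex mat \<Rightarrow> real" where
  "output_weight 0 r P \<psi> =
     (case P of Output s \<Rightarrow> if s = r then sqnorm \<psi> else 0 | Round p bs \<Rightarrow> 0)"
| "output_weight (Suc n) r P \<psi> =
     (case P of Output s \<Rightarrow> if s = r then sqnorm \<psi> else 0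
      | Round p bs \<Rightarrow>
          (\<Sum>(Ks, Q) \<leftarrow> bs. \<Sum>K \<leftarrow> Ks. output_weight n r Q (local_op p K \<psi>)))"

definition output_prob :: "nat \<Rightarrow> 'r \<Rightarrow> 'r locc \<Rightarrow> complex mat \<Rightarrow> real" where
  "output_prob n r P \<psi> = output_weight n r P \<psi> / sqnorm \<psi>"

definition outputs_with_certainty :: "'r \<Rightarrow> 'r locc \<Rightarrow> complex mat \<Rightarrow> bool" where
  "outputs_with_certainty r P \<psi> \<longleftrightarrow> (\<lambda>n. output_prob n r P \<psi>) \<longlonglongrightarrow> 1"


section \<open>Local marking\<close>

text \<open>
  A set of \<open>m\<close> states in \<open>\<complex>\<^bsup>dA\<^esup> \<otimes> \<complex>\<^bsup>dB\<^esup>\<close> is given by an enumeration; permutations act on the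
  positions \<open>0, \<dots>, m - 1\<close>.
\<close>

definition permuted_state :: "complex mat list \<Rightarrow> (nat \<Rightarrow> nat) \<Rightarrow> complex mat" where
  "permuted_state \<chi>s \<pi> = kron_list (map (\<lambda>k. \<chi>s ! \<pi> k) [0..<length \<chi>s])"

definition locally_markable :: "nat \<Rightarrow> nat \<Rightarrow> complex mat list \<Rightarrow> bool" where
  "locally_markable dA dB \<chi>s \<longleftrightarrow>
     (\<exists>P :: (nat \<Rightarrow> nat) locc.
        valid_locc (dA ^ length \<chi>s) (dB ^ length \<chi>s) P \<and>
        (\<forall>\<pi>. \<pi> permutes {..<length \<chi>s} \<longrightarrow>
           outputs_with_certainty \<pi> P (permuted_state \<chi>s \<pi>)))"

abbreviation locally_unmarkable :: "nat \<Rightarrow> nat \<Rightarrow> complex mat list \<Rightarrow> bool" where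
  "locally_unmarkable dA dB \<chi>s \<equiv> \<not> locally_markable dA dB \<chi>s"


section \<open>Local orthogonality preserving measurements\<close>

definition post_states :: "party \<Rightarrow> complex mat \<Rightarrow> complex mat list \<Rightarrow> complex mat list" where
  "post_states p M \<chi>s =
     filter (\<lambda>\<psi>. \<psi> \<noteq> 0\<^sub>m (dim_row \<psi>) (dim_col \<psi>)) (map (local_op p M) \<chi>s)"

definition local_OPM ::
    "nat \<Rightarrow> nat \<Rightarrow> party \<Rightarrow> complex mat list \<Rightarrow> complex mat list \<Rightarrow> bool" where
  "local_OPM dA dB p Ms \<chi>s \<longleftrightarrow>
     (let d = (case p of Alice \<Rightarrow> dA | Bob \<Rightarrow> dB)
      in (\<forall>M \<in> set Ms. M \<in> carrier_mat d d) \<and> kraus_complete d Ms) \<and>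
     (\<forall>M \<in> set Ms. mutually_orthogonal (post_states p M \<chi>s))"

definition deterministically_converted_via_local_OPM ::
    "nat \<Rightarrow> nat \<Rightarrow> complex mat list \<Rightarrow> (complex mat list \<Rightarrow> bool) \<Rightarrow> bool" where
  "deterministically_converted_via_local_OPM dA dB \<chi>s Q \<longleftrightarrow>
     (\<exists>p Ms. local_OPM dA dB p Ms \<chi>s \<and> (\<forall>M \<in> set Ms. Q (post_states p M \<chi>s)))"


section \<open>The set of states\<close>

definition ket :: "nat \<Rightarrow> nat \<Rightarrow> complex mat" where
  "ket a b = tensor_vec (unit_vec 2 a) (unit_vec 4 b)"

definition \<psi>1 :: "complex mat" where "\<psi>1 = ket 0 0 + ket 0 2 + ket 1 1 - ket 1 3"
definition \<psi>2 :: "complex mat" where "\<psi>2 = ket 0 0 - ket 0 2 - ket 1 1 - ket 1 3"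
definition \<psi>3 :: "complex mat" where "\<psi>3 = ket 0 1 - ket 1 2 - ket 1 0 - ket 0 3"
definition \<psi>4 :: "complex mat" where "\<psi>4 = ket 0 1 - ket 1 2 + ket 1 0 + ket 0 3"

definition S1 :: "complex mat list" where
  "S1 = [\<psi>1, \<psi>2, \<psi>3, \<psi>4]"

lemma dim_ket [simp]: "dim_row (ket a b) = 2" "dim_col (ket a b) = 4"
  by (simp_all add: ket_def tensor_vec_def)

lemma ket_index [simp]:
  "i < 2 \<Longrightarrow> j < 4 \<Longrightarrow> ket a b $$ (i, j) = (if i = a \<and> j = b then 1 else 0)"
  by (simp add: ket_def tensor_vec_def unit_vec_def)

lemma S1_carrier: "set S1 \<subseteq> carrier_mat 2 4"
proof -
  have "\<psi>1 \<in> carrier_mat 2 4" "\<psi>2 \<in> carrier_mat 2 4" "\<psi>3 \<in> carrier_mat 2 4" "\<psi>4 \<in> carrier_mat 2 4"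
    by (rule carrier_matI; simp add: \<psi>1_def \<psi>2_def \<psi>3_def \<psi>4_def)+
  then show ?thesis
    by (simp add: S1_def)
qed

lemma S1_entries [simp]:
  assumes "i < 2" "j < 4"
  shows "\<psi>1 $$ (i, j) = (if (i, j) \<in> {(0, 0), (0, 2), (1, 1)} then 1 else if (i, j) = (1, 3) then -1 else 0)"
    and "\<psi>2 $$ (i, j) = (if (i, j) = (0, 0) then 1 else if (i, j) \<in> {(0, 2), (1, 1), (1, 3)} then -1 else 0)"
    and "\<psi>3 $$ (i, j) = (if (i, j) = (0, 1) then 1 else if (i, j) \<in> {(1, 2), (1, 0), (0, 3)} then -1 else 0)"
    and "\<psi>4 $$ (i, j) = (if (i, j) = (1, 2) then -1 else if (i, j) \<in> {(0, 1), (1, 0), (0, 3)} then 1 else 0)"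
proof -
  have ij: "i = 0 \<or> i = 1" "j = 0 \<or> j = 1 \<or> j = 2 \<or> j = 3"
    using assms by linarith+
  show "\<psi>1 $$ (i, j) = (if (i, j) \<in> {(0, 0), (0, 2), (1, 1)} then 1 else if (i, j) = (1, 3) then -1 else 0)"
    using ij by (elim disjE) (simp_all add: \<psi>1_def)
  show "\<psi>2 $$ (i, j) = (if (i, j) = (0, 0) then 1 else if (i, j) \<in> {(0, 2), (1, 1), (1, 3)} then -1 else 0)"
    using ij by (elim disjE) (simp_all add: \<psi>2_def)
  show "\<psi>3 $$ (i, j) = (if (i, j) = (0, 1) then 1 else if (i, j) \<in> {(1, 2), (1, 0), (0, 3)} then -1 else 0)"
    using ij by (elim disjE) (simp_all add: \<psi>3_def)
  show "\<psi>4 $$ (i, j) = (if (i, j) = (1, 2) then -1 else if (i, j) \<in> {(0, 1), (1, 0), (0, 3)} then 1 else 0)"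
    using ij by (elim disjE) (simp_all add: \<psi>4_def)
qed

lemma S1_orthogonal: "mutually_orthogonal S1"
proof -
  have two: "{..<2} = {0, 1::nat}" and four: "{..<4} = {0, 1, 2, 3::nat}"
    by auto
  have len: "length S1 = 4"
    by (simp add: S1_def)
  have nth: "S1 ! 0 = \<psi>1" "S1 ! 1 = \<psi>2" "S1 ! 2 = \<psi>3" "S1 ! 3 = \<psi>4"
    by (simp_all add: S1_def)
  have dims: "dim_row \<psi>1 = 2" "dim_row \<psi>2 = 2" "dim_row \<psi>3 = 2" "dim_row \<psi>4 = 2"
    "dim_col \<psi>1 = 4" "dim_col \<psi>2 = 4" "dim_col \<psi>3 = 4" "dim_col \<psi>4 = 4"
    by (simp_all add: \<psi>1_def \<psi>2_def \<psi>3_def \<psi>4_def)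
  have orth: "braket \<psi>1 \<psi>2 = 0" "braket \<psi>1 \<psi>3 = 0" "braket \<psi>1 \<psi>4 = 0"
    "braket \<psi>2 \<psi>1 = 0" "braket \<psi>2 \<psi>3 = 0" "braket \<psi>2 \<psi>4 = 0"
    "braket \<psi>3 \<psi>1 = 0" "braket \<psi>3 \<psi>2 = 0" "braket \<psi>3 \<psi>4 = 0"
    "braket \<psi>4 \<psi>1 = 0" "braket \<psi>4 \<psi>2 = 0" "braket \<psi>4 \<psi>3 = 0"
    by (simp_all add: braket_def dims two four)
  have cases: "i = 0 \<or> i = 1 \<or> i = 2 \<or> i = 3" if "i < 4" for i :: nat
    using that by linarith
  show ?thesis
    unfolding mutually_orthogonal_def len
  proof (intro allI impI)
    fix i j :: nat
    assume "i < 4" "j < 4" and ij: "i \<noteq> j"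
    from cases[OF \<open>i < 4\<close>] cases[OF \<open>j < 4\<close>] ij
    show "braket (S1 ! i) (S1 ! j) = 0"
      by (elim disjE; simp only: nth orth simp_thms)
  qed
qed

end

theory Submission
  imports Defs "HOL-Analysis.Convex"
begin

text \<open>
  Bob projects onto the span of levels 0, 1 or of levels 2, 3; either outcome leaves the four Bell
  states. The 24 orderings of four Bell states are maximally entangled states of rank 16 in a common
  16-by-16 subspace, and no LOCC protocol identifies more than \<open>d\<close> maximally entangled states
  of a \<open>d\<close>-by-\<open>d\<close> system with certainty: the success probabilities sum to at most \<open>d\<close>.
\<close>

section \<open>Frobenius norm and adjoints\<close>

lemma mat_adjoint_carrier: "A \<in> carrier_mat m n \<Longrightarrow> mat_adjoint A \<in> carrier_mat n m"
  by (auto simp: mat_adjoint_def)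

lemma dim_mat_adjoint [simp]:
  "dim_row (mat_adjoint A) = dim_col A" "dim_col (mat_adjoint A) = dim_row A"
  by (simp_all add: mat_adjoint_def)

lemma mat_adjoint_index [simp]:
  fixes A :: "complex mat"
  assumes "i < dim_col A" "j < dim_row A"
  shows "mat_adjoint A $$ (i, j) = cnj (A $$ (j, i))"
  using assms by (simp add: mat_adjoint_def mat_of_rows_def)

lemma mult_mat_index:
  assumes "A \<in> carrier_mat m n" "B \<in> carrier_mat n c" "i < m" "j < c"
  shows "(A * B) $$ (i, j) = (\<Sum>k<n. A $$ (i, k) * B $$ (k, j))"
  using assms by (auto simp: scalar_prod_def lessThan_atLeast0)

lemma braket_carrier:
  "A \<in> carrier_mat m n \<Longrightarrow>
    braket A B = (\<Sum>i<m. \<Sum>j<n. cnj (A $$ (i, j)) * B $$ (i, j))"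
  by (auto simp: braket_def)

lemma sqnorm_eq: "sqnorm A = (\<Sum>i<dim_row A. \<Sum>j<dim_col A. (cmod (A $$ (i, j)))\<^sup>2)"
  unfolding sqnorm_def braket_def Re_sum
  by (intro sum.cong refl) (simp add: cmod_power2, simp add: power2_eq_square)

lemma sqnorm_carrier:
  "A \<in> carrier_mat m n \<Longrightarrow> sqnorm A = (\<Sum>i<m. \<Sum>j<n. (cmod (A $$ (i, j)))\<^sup>2)"
  by (auto simp: sqnorm_eq)

lemma sqnorm_nonneg: "0 \<le> sqnorm A"
  unfolding sqnorm_eq by (intro sum_nonneg) simp

lemma sqnorm_transpose: "sqnorm (transpose_mat A) = sqnorm A"
  unfolding sqnorm_eq by (simp add: sum.swap[of _ "{..<dim_row A}"])

lemma sqnorm_one: "sqnorm (1\<^sub>m d) = d"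
proof -
  have "sqnorm (1\<^sub>m d) = (\<Sum>i<d. \<Sum>j<d. if i = j then 1 else 0)"
    unfolding sqnorm_carrier[OF one_carrier_mat] by (intro sum.cong refl) auto
  then show ?thesis
    by simp
qed

lemma braket_mult_left:
  assumes K: "K \<in> carrier_mat m d" and A: "A \<in> carrier_mat d c" and B: "B \<in> carrier_mat m c"
  shows "braket (K * A) B = braket A (mat_adjoint K * B)"
proof -
  have "braket (K * A) B =
      (\<Sum>i<m. \<Sum>j<c. \<Sum>k<d. cnj (K $$ (i, k)) * cnj (A $$ (k, j)) * B $$ (i, j))"
    using assms
    by (simp add: braket_carrier[OF mult_carrier_mat[OF K A]] mult_mat_index[OF K A] sum_distrib_right
        del: index_mult_mat)
  also have "\<dots> = (\<Sum>i<m. \<Sum>k<d. \<Sum>j<c. cnj (K $$ (i, k)) * cnj (A $$ (k, j)) * B $$ (i, j))"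
    by (intro sum.cong refl sum.swap)
  also have "\<dots> = (\<Sum>k<d. \<Sum>i<m. \<Sum>j<c. cnj (K $$ (i, k)) * cnj (A $$ (k, j)) * B $$ (i, j))"
    by (rule sum.swap)
  also have "\<dots> = (\<Sum>k<d. \<Sum>j<c. \<Sum>i<m. cnj (K $$ (i, k)) * cnj (A $$ (k, j)) * B $$ (i, j))"
    by (intro sum.cong refl sum.swap)
  also have "\<dots> = braket A (mat_adjoint K * B)"
    using assms
    by (simp add: braket_carrier[OF A] mult_mat_index[OF mat_adjoint_carrier[OF K] B]
        sum_distrib_left ac_simps del: index_mult_mat)
  finally show ?thesis .
qed

lemma braket_mult_right:
  assumes A: "A \<in> carrier_mat m d" and K: "K \<in> carrier_mat d c" and B: "B \<in> carrier_mat m c"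
  shows "braket (A * K) B = braket A (B * mat_adjoint K)"
proof -
  have "braket (A * K) B =
      (\<Sum>i<m. \<Sum>j<c. \<Sum>k<d. cnj (A $$ (i, k)) * cnj (K $$ (k, j)) * B $$ (i, j))"
    using assms
    by (simp add: braket_carrier[OF mult_carrier_mat[OF A K]] mult_mat_index[OF A K] sum_distrib_right
        del: index_mult_mat)
  also have "\<dots> = (\<Sum>i<m. \<Sum>k<d. \<Sum>j<c. cnj (A $$ (i, k)) * cnj (K $$ (k, j)) * B $$ (i, j))"
    by (intro sum.cong refl sum.swap)
  also have "\<dots> = braket A (B * mat_adjoint K)"
    using assms
    by (simp add: braket_carrier[OF A] mult_mat_index[OF B mat_adjoint_carrier[OF K]]
        sum_distrib_left ac_simps del: index_mult_mat)
  finally show ?thesis .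
qed

text \<open>Moving \<open>X\<close> across the inner product makes it meet its adjoint and cancel.
  Read as a state, such an \<open>X\<close> leaves Alice maximally mixed, so the weight of her
  operator \<open>A\<close> is the same for every such \<open>X\<close>.\<close>

lemma sqnorm_mult_coisometry:
  assumes "A \<in> carrier_mat m a" "X \<in> carrier_mat a b" "X * mat_adjoint X = 1\<^sub>m a"
  shows "sqnorm (A * X) = sqnorm A"
  using assms
  by (simp add: sqnorm_def braket_mult_right[of A m a X b] assoc_mult_mat[OF _ _ mat_adjoint_carrier])

text \<open>Cauchy-Schwarz on each entry pairs a row of \<open>A\<close> with a column of
  \<open>B\<close>; the double sum over entries then factorizes.\<close>

lemma sqnorm_mult_le:
  assumes A: "A \<in> carrier_mat m n" and B: "B \<in> carrier_mat n c"
  shows "sqnorm (A * B) \<le> sqnorm A * sqnorm B"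
proof -
  have entry: "(cmod ((A * B) $$ (i, j)))\<^sup>2 \<le>
      (\<Sum>k<n. (cmod (A $$ (i, k)))\<^sup>2) * (\<Sum>k<n. (cmod (B $$ (k, j)))\<^sup>2)"
    if "i < m" "j < c" for i j
  proof -
    have "cmod ((A * B) $$ (i, j)) \<le> (\<Sum>k<n. cmod (A $$ (i, k)) * cmod (B $$ (k, j)))"
      unfolding mult_mat_index[OF A B that] by (rule order_trans[OF norm_sum]) (simp add: norm_mult)
    then have "(cmod ((A * B) $$ (i, j)))\<^sup>2 \<le> (\<Sum>k<n. cmod (A $$ (i, k)) * cmod (B $$ (k, j)))\<^sup>2"
      by (intro power_mono) auto
    also have "\<dots> \<le> (\<Sum>k<n. (cmod (A $$ (i, k)))\<^sup>2) * (\<Sum>k<n. (cmod (B $$ (k, j)))\<^sup>2)"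
      by (rule Cauchy_Schwarz_ineq_sum)
    finally show ?thesis .
  qed
  have "sqnorm (A * B) \<le>
      (\<Sum>i<m. \<Sum>j<c. (\<Sum>k<n. (cmod (A $$ (i, k)))\<^sup>2) * (\<Sum>k<n. (cmod (B $$ (k, j)))\<^sup>2))"
    unfolding sqnorm_carrier[OF mult_carrier_mat[OF A B]] by (intro sum_mono entry) auto
  also have "\<dots> = sqnorm A * sqnorm B"
    unfolding sqnorm_carrier[OF A] sqnorm_carrier[OF B] sum.swap[of _ "{..<c}" "{..<n}"]
    by (simp only: sum_product)
  finally show ?thesis .
qed

text \<open>The Gram sum \<open>G\<close> is kept general because the tail of a complete list need
  not be complete, so completeness itself could not be the induction invariant. Each operator has
  its own \<open>m\<close>, since outcomes may change the dimension differently.\<close>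

lemma sum_sqnorm_kraus_gram:
  assumes A: "A \<in> carrier_mat d c" and "\<forall>K \<in> set Ks. \<exists>m. K \<in> carrier_mat m d"
  defines "G \<equiv> foldr (\<lambda>K S. mat_adjoint K * K + S) Ks (0\<^sub>m d d)"
  shows "G \<in> carrier_mat d d \<and> (\<Sum>K\<leftarrow>Ks. sqnorm (K * A)) = Re (braket A (G * A))"
  using assms(2) unfolding G_def
proof (induction Ks)
  case Nil
  then show ?case
    using A by (simp add: braket_carrier[OF A])
next
  case (Cons K Ks)
  define S where "S = foldr (\<lambda>K S. mat_adjoint K * K + S) Ks (0\<^sub>m d d)"
  have S: "S \<in> carrier_mat d d" and IH: "(\<Sum>K\<leftarrow>Ks. sqnorm (K * A)) = Re (braket A (S * A))"
    using Cons by (auto simp: S_def)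
  obtain m where K: "K \<in> carrier_mat m d"
    using Cons.prems by auto
  note K' = mat_adjoint_carrier[OF K]
  have KA: "K * A \<in> carrier_mat m c" and KK: "mat_adjoint K * K \<in> carrier_mat d d"
    using A K K' by auto
  have "(mat_adjoint K * K + S) * A = mat_adjoint K * (K * A) + S * A"
    using A K K' KK S by (simp add: add_mult_distrib_mat[of _ d d] assoc_mult_mat[OF K' K A])
  moreover have "mat_adjoint K * (K * A) \<in> carrier_mat d c" "S * A \<in> carrier_mat d c"
    using K' KA S A by auto
  ultimately have "braket A ((mat_adjoint K * K + S) * A) =
      braket A (mat_adjoint K * (K * A)) + braket A (S * A)"
    by (auto simp: braket_carrier[OF A] distrib_left sum.distrib simp del: index_mult_mat)
  then show ?case
    using KK S by (simp add: IH[symmetric] flip: S_def) (simp add: IH sqnorm_def braket_mult_left[OF K A KA])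
qed

lemma sum_sqnorm_kraus:
  assumes "kraus_complete d Ks" "A \<in> carrier_mat d c" "\<forall>K \<in> set Ks. \<exists>m. K \<in> carrier_mat m d"
  shows "(\<Sum>K\<leftarrow>Ks. sqnorm (K * A)) = sqnorm A"
  using sum_sqnorm_kraus_gram[OF assms(2,3)] assms(1,2)
  by (simp add: kraus_complete_def sqnorm_def)

section \<open>LOCC on maximally entangled states\<close>

lemma sum_sum_list_swap:
  fixes f :: "'a \<Rightarrow> 'b \<Rightarrow> 'c :: comm_monoid_add"
  shows "(\<Sum>x\<in>A. \<Sum>y\<leftarrow>ys. f x y) = (\<Sum>y\<leftarrow>ys. \<Sum>x\<in>A. f x y)"
  by (induction ys) (simp_all add: sum.distrib)

lemma sum_list_concat_fst:
  fixes f :: "'a \<Rightarrow> real"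
  shows "(\<Sum>(Ks, Q)\<leftarrow>bs. \<Sum>K\<leftarrow>Ks. f K) = (\<Sum>K\<leftarrow>concat (map fst bs). f K)"
  by (induction bs) auto

text \<open>Branches are nested outcome by outcome, whereas completeness concerns the flattened list
  of Kraus operators; this passes from a bound per operator to that list.\<close>

lemma sum_branches_le:
  fixes w :: "'r \<Rightarrow> 'q \<Rightarrow> 'k \<Rightarrow> real"
  assumes "\<And>Ks Q K. (Ks, Q) \<in> set bs \<Longrightarrow> K \<in> set Ks \<Longrightarrow> (\<Sum>r\<in>R. w r Q K) \<le> g K"
  shows "(\<Sum>r\<in>R. \<Sum>(Ks, Q)\<leftarrow>bs. \<Sum>K\<leftarrow>Ks. w r Q K) \<le> (\<Sum>K\<leftarrow>concat (map fst bs). g K)"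
proof -
  have "(\<Sum>r\<in>R. \<Sum>(Ks, Q)\<leftarrow>bs. \<Sum>K\<leftarrow>Ks. w r Q K) =
      (\<Sum>(Ks, Q)\<leftarrow>bs. \<Sum>K\<leftarrow>Ks. \<Sum>r\<in>R. w r Q K)"
    by (simp add: sum_sum_list_swap case_prod_unfold)
  also have "\<dots> \<le> (\<Sum>(Ks, Q)\<leftarrow>bs. \<Sum>K\<leftarrow>Ks. g K)"
    using assms by (auto intro!: sum_list_mono)
  finally show ?thesis
    by (simp add: sum_list_concat_fst)
qed

text \<open>A leaf names a single value, so only one member of the family gains weight there. This
  is why the bound below carries no factor \<open>card R\<close>.\<close>

lemma sum_output_weight_Output:
  assumes "finite R"
  shows "(\<Sum>r\<in>R. output_weight n r (Output s) (\<phi> r)) = (if s \<in> R then sqnorm (\<phi> s) else 0)"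
  using assms by (cases n) simp_all

text \<open>
  After some rounds the state \<open>X r\<close> has become \<open>(A \<otimes> B) X r\<close>, where \<open>A\<close> and \<open>B\<close> do not
  depend on \<open>r\<close>. Whichever \<open>r\<close> is then output, its weight is at most the product of the squared
  Frobenius norms of \<open>A\<close> and \<open>B\<close>, and completeness preserves the sum of these products.
\<close>

lemma sum_output_weight_le:
  fixes X :: "'r \<Rightarrow> complex mat"
  assumes fin: "finite R"
    and X: "\<And>r. r \<in> R \<Longrightarrow> X r \<in> carrier_mat a b"
    and XX: "\<And>r. r \<in> R \<Longrightarrow> X r * mat_adjoint (X r) = 1\<^sub>m a"
    and "valid_locc dA dB P" "A \<in> carrier_mat dA a" "B \<in> carrier_mat dB b"
  shows "(\<Sum>r\<in>R. output_weight n r P (A * X r * transpose_mat B)) \<le> sqnorm A * sqnorm B"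
  using assms(4-)
proof (induction n arbitrary: dA dB P A B)
  case (0 dA dB P A B)
  \<comment> \<open>Submultiplicativity splits off \<open>transpose_mat B\<close>, and
    \<open>X s\<close> then cancels as a coisometry.\<close>
  have out: "sqnorm (A * X s * transpose_mat B) \<le> sqnorm A * sqnorm B" if "s \<in> R" for s
    using sqnorm_mult_le[of "A * X s" dA b "transpose_mat B" dB] that 0 X[OF that]
    by (simp add: sqnorm_mult_coisometry[OF _ X XX] sqnorm_transpose)
  show ?case
  proof (cases P)
    case (Output s)
    then show ?thesis
      using sum_output_weight_Output[OF fin, of 0 s "\<lambda>r. A * X r * transpose_mat B"] out
      by (auto simp: sqnorm_nonneg simp del: output_weight.simps)
  next
    \<comment> \<open>With no rounds left, an unfinished protocol has weight 0.\<close>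
    case (Round p bs)
    then show ?thesis
      by (simp add: sqnorm_nonneg)
  qed
next
  case (Suc n dA dB P A B)
  note A = Suc.prems(2) and B = Suc.prems(3)
  from Suc.prems(1) show ?case
  proof cases
    case (valid_Output s)
    have "sqnorm (A * X s * transpose_mat B) \<le> sqnorm A * sqnorm B" if "s \<in> R"
      using sqnorm_mult_le[of "A * X s" dA b "transpose_mat B" dB] that Suc.prems X[OF that]
      by (simp add: sqnorm_mult_coisometry[OF _ X XX] sqnorm_transpose)
    then show ?thesis
      using sum_output_weight_Output[OF fin, of "Suc n" s "\<lambda>r. A * X r * transpose_mat B"]
      by (auto simp: valid_Output sqnorm_nonneg simp del: output_weight.simps)
  next
    case (valid_Alice bs)
    have "(\<Sum>r\<in>R. output_weight n r Q (local_op Alice K (A * X r * transpose_mat B)))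
        \<le> sqnorm (K * A) * sqnorm B" if branch: "(Ks, Q) \<in> set bs" "K \<in> set Ks" for Ks Q K
    proof -
      obtain d where K: "K \<in> carrier_mat d dA" and Q: "valid_locc d dB Q"
        using bspec[OF valid_Alice(3) branch(1)] branch(2) by auto
      \<comment> \<open>Bob's operators act from the right, so associativity absorbs
        \<open>K\<close> into \<open>A\<close>, and the induction hypothesis applies with Alice's
        new dimension \<open>d\<close>.\<close>
      have "local_op Alice K (A * X r * transpose_mat B) = K * A * X r * transpose_mat B"
        if "r \<in> R" for r
        using K A X[OF that] B
        by (simp add: assoc_mult_mat[of K d dA _ b _ dB] assoc_mult_mat[of K d dA A a _ b]
            assoc_mult_mat[of "K * A" d a _ b _ dB] assoc_mult_mat[of K d dA A a _ dB]
            assoc_mult_mat[of A dA a _ b _ dB])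
      then show ?thesis
        using Suc.IH[OF Q _ B, of "K * A"] K A by simp
    qed
    then have "(\<Sum>r\<in>R. output_weight (Suc n) r P (A * X r * transpose_mat B)) \<le>
        (\<Sum>K\<leftarrow>concat (map fst bs). sqnorm (K * A) * sqnorm B)"
      unfolding valid_Alice by (simp add: sum_branches_le del: local_op.simps)
    also have "\<dots> = (\<Sum>K\<leftarrow>concat (map fst bs). sqnorm (K * A)) * sqnorm B"
      by (rule sum_list_mult_const)
    also have "\<dots> = sqnorm A * sqnorm B"
      using sum_sqnorm_kraus[OF valid_Alice(2) A] valid_Alice(3) by fastforce
    finally show ?thesis .
  next
    case (valid_Bob bs)
    have "(\<Sum>r\<in>R. output_weight n r Q (local_op Bob K (A * X r * transpose_mat B)))
        \<le> sqnorm A * sqnorm (K * B)" if branch: "(Ks, Q) \<in> set bs" "K \<in> set Ks" for Ks Q K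
    proof -
      obtain d where K: "K \<in> carrier_mat d dB" and Q: "valid_locc dA d Q"
        using bspec[OF valid_Bob(3) branch(1)] branch(2) by auto
      \<comment> \<open>Bob's \<open>K\<close> acts as right multiplication by its transpose;
        carrying \<open>B\<close> transposed makes the accumulated operator simply
        \<open>K * B\<close>.\<close>
      have "local_op Bob K (A * X r * transpose_mat B) = A * X r * transpose_mat (K * B)"
        if "r \<in> R" for r
        using K A X[OF that] B
        by (simp add: transpose_mult[OF K B] assoc_mult_mat[of "A * X r" dA b _ dB _ d]
            del: assoc_mult_mat)
      then show ?thesis
        using Suc.IH[OF Q A, of "K * B"] K B by simp
    qed
    then have "(\<Sum>r\<in>R. output_weight (Suc n) r P (A * X r * transpose_mat B)) \<le>
        (\<Sum>K\<leftarrow>concat (map fst bs). sqnorm A * sqnorm (K * B))"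
      unfolding valid_Bob by (simp add: sum_branches_le del: local_op.simps)
    also have "\<dots> = sqnorm A * (\<Sum>K\<leftarrow>concat (map fst bs). sqnorm (K * B))"
      by (rule sum_list_const_mult)
    also have "\<dots> = sqnorm A * sqnorm B"
      using sum_sqnorm_kraus[OF valid_Bob(2) B] valid_Bob(3) by fastforce
    finally show ?thesis .
  qed
qed

section \<open>Kronecker products\<close>

lemma kron_carrier:
  "A \<in> carrier_mat a b \<Longrightarrow> B \<in> carrier_mat c d \<Longrightarrow> kron A B \<in> carrier_mat (a * c) (b * d)"
  by (auto simp: kron_def)

lemma div_mod_less:
  fixes i :: nat
  assumes "i < a * c"
  shows "i div c < a" "i mod c < c"
  using assms by (cases "c = 0"; simp add: less_mult_imp_div_less)+

lemma kron_index:
  assumes "A \<in> carrier_mat a b" "B \<in> carrier_mat c d" "i < a * c" "j < b * d"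
  shows "kron A B $$ (i, j) = A $$ (i div c, j div d) * B $$ (i mod c, j mod d)"
  using assms by (auto simp: kron_def)

text \<open>The index \<open>k = x * b + y\<close> has the two digits \<open>x\<close> and
  \<open>y\<close>; sums over Kronecker indices are decoupled this way.\<close>

lemma sum_div_mod:
  fixes f :: "nat \<Rightarrow> nat \<Rightarrow> 'a :: comm_monoid_add"
  shows "(\<Sum>k<a * b. f (k div b) (k mod b)) = (\<Sum>x<a. \<Sum>y<b. f x y)"
proof -
  have "(\<Sum>k<a * b. f (k div b) (k mod b)) = (\<Sum>(x, y)\<in>{..<a} \<times> {..<b}. f x y)"
  proof (rule sum.reindex_bij_witness[where j = "\<lambda>k. (k div b, k mod b)" and i = "\<lambda>(x, y). x * b + y"])
    fix p assume "p \<in> {..<a} \<times> {..<b}"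
    then obtain x y where p: "p = (x, y)" "x < a" "y < b" by auto
    have "x * b + y < Suc x * b" using p by simp
    also have "\<dots> \<le> a * b" using p by (intro mult_le_mono1) simp
    finally show "(case p of (x, y) \<Rightarrow> x * b + y) \<in> {..<a * b}" using p by simp
  qed (auto simp: div_mod_less)
  then show ?thesis
    by (simp add: sum.cartesian_product)
qed

lemma kron_mult:
  assumes A: "A \<in> carrier_mat a b" and B: "B \<in> carrier_mat c d"
    and A': "A' \<in> carrier_mat b e" and B': "B' \<in> carrier_mat d f"
  shows "kron A B * kron A' B' = kron (A * A') (B * B')"
proof (rule eq_matI)
  note AB = kron_carrier[OF A B] and AB' = kron_carrier[OF A' B']
    and AA = mult_carrier_mat[OF A A'] and BB = mult_carrier_mat[OF B B']
  fix i j assume "i < dim_row (kron (A * A') (B * B'))" "j < dim_col (kron (A * A') (B * B'))"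
  then have i: "i < a * c" and j: "j < e * f"
    using kron_carrier[OF AA BB] by auto
  have "(kron A B * kron A' B') $$ (i, j) =
      (\<Sum>k<b * d. (A $$ (i div c, k div d) * B $$ (i mod c, k mod d)) *
        (A' $$ (k div d, j div f) * B' $$ (k mod d, j mod f)))"
    unfolding mult_mat_index[OF AB AB' i j]
    by (intro sum.cong refl) (simp add: kron_index[OF A B i] kron_index[OF A' B' _ j])
  also have "\<dots> = (\<Sum>x<b. \<Sum>y<d. (A $$ (i div c, x) * B $$ (i mod c, y)) *
        (A' $$ (x, j div f) * B' $$ (y, j mod f)))"
    by (rule sum_div_mod)
  also have "\<dots> = (A * A') $$ (i div c, j div f) * (B * B') $$ (i mod c, j mod f)"
    unfolding mult_mat_index[OF A A' div_mod_less(1)[OF i] div_mod_less(1)[OF j]]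
      mult_mat_index[OF B B' div_mod_less(2)[OF i] div_mod_less(2)[OF j]]
    by (simp add: sum_product ac_simps)
  also have "\<dots> = kron (A * A') (B * B') $$ (i, j)"
    by (simp add: kron_index[OF AA BB i j] del: index_mult_mat)
  finally show "(kron A B * kron A' B') $$ (i, j) = kron (A * A') (B * B') $$ (i, j)" .
qed (use assms in \<open>auto simp: kron_def\<close>)

lemma kron_transpose: "transpose_mat (kron A B) = kron (transpose_mat A) (transpose_mat B)"
  by (rule eq_matI) (auto simp: kron_def div_mod_less)

lemma kron_mat_adjoint: "mat_adjoint (kron A B) = kron (mat_adjoint A) (mat_adjoint B)"
  by (rule eq_matI) (auto simp: kron_def div_mod_less)

lemma kron_one: "kron (1\<^sub>m a) (1\<^sub>m b) = 1\<^sub>m (a * b)"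
proof (rule eq_matI)
  fix i j assume "i < dim_row (1\<^sub>m (a * b))" "j < dim_col (1\<^sub>m (a * b))"
  then have ij: "i < a * b" "j < a * b" by auto
  have "i = j \<longleftrightarrow> i div b = j div b \<and> i mod b = j mod b"
    by (metis div_mod_decomp)
  with ij show "kron (1\<^sub>m a) (1\<^sub>m b) $$ (i, j) = 1\<^sub>m (a * b) $$ (i, j)"
    by (auto simp: kron_def div_mod_less)
qed (auto simp: kron_def)

lemma sqnorm_kron: "sqnorm (kron A B) = sqnorm A * sqnorm B"
proof -
  \<comment> \<open>\<open>g\<close> collects the column sums for a fixed pair of rows, so that
    \<open>sum_div_mod\<close> can be applied once to columns and once to rows.\<close>
  define g where "g x y = (\<Sum>z<dim_col A. \<Sum>w<dim_col B. (cmod (A $$ (x, z) * B $$ (y, w)))\<^sup>2)" for x y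
  have "sqnorm (kron A B) = (\<Sum>i<dim_row A * dim_row B. \<Sum>j<dim_col A * dim_col B.
      (cmod (A $$ (i div dim_row B, j div dim_col B) * B $$ (i mod dim_row B, j mod dim_col B)))\<^sup>2)"
    by (simp add: sqnorm_eq kron_def)
  also have "\<dots> = (\<Sum>i<dim_row A * dim_row B. g (i div dim_row B) (i mod dim_row B))"
    unfolding g_def by (intro sum.cong refl sum_div_mod)
  also have "\<dots> = (\<Sum>x<dim_row A. \<Sum>y<dim_row B. g x y)"
    by (rule sum_div_mod)
  also have "\<dots> = sqnorm A * sqnorm B"
    by (simp add: g_def sqnorm_eq norm_mult power_mult_distrib sum_product)
  finally show ?thesis .
qed

lemma kron_list_simps [simp]:
  "kron_list [] = 1\<^sub>m 1" "kron_list (\<chi> # \<chi>s) = kron \<chi> (kron_list \<chi>s)"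
  by (simp_all add: kron_list_def)

lemma kron_list_carrier:
  "set \<chi>s \<subseteq> carrier_mat a b \<Longrightarrow> kron_list \<chi>s \<in> carrier_mat (a ^ length \<chi>s) (b ^ length \<chi>s)"
  by (induction \<chi>s) (auto intro!: kron_carrier)

text \<open>Adjoints and products act factorwise on Kronecker products, so maximal entanglement with
  Alice's whole space survives tensoring.\<close>

lemma kron_list_coisometry:
  assumes "set \<chi>s \<subseteq> carrier_mat a b" "\<forall>\<chi> \<in> set \<chi>s. \<chi> * mat_adjoint \<chi> = 1\<^sub>m a"
  shows "kron_list \<chi>s * mat_adjoint (kron_list \<chi>s) = 1\<^sub>m (a ^ length \<chi>s)"
  using assms
proof (induction \<chi>s)
  case Nil
  show ?case by (rule eq_matI) (auto simp: scalar_prod_def)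
next
  case (Cons \<chi> \<chi>s)
  then have "\<chi> \<in> carrier_mat a b" "kron_list \<chi>s \<in> carrier_mat (a ^ length \<chi>s) (b ^ length \<chi>s)"
    by (auto intro!: kron_list_carrier)
  with Cons show ?case
    by (simp add: kron_mat_adjoint kron_one kron_mult[OF _ _ mat_adjoint_carrier mat_adjoint_carrier])
qed

text \<open>The same \<open>E\<close> sits in every factor, so one operator on Bob's side fixes the
  tensor product in whatever order the states come.\<close>

lemma kron_list_support:
  assumes "set \<chi>s \<subseteq> carrier_mat a b" "E \<in> carrier_mat b b"
    "\<forall>\<chi> \<in> set \<chi>s. \<chi> * transpose_mat E = \<chi>"
  shows "kron_list \<chi>s * transpose_mat (kron_list (replicate (length \<chi>s) E)) = kron_list \<chi>s"
  using assms
proof (induction \<chi>s)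
  case (Cons \<chi> \<chi>s)
  then have "\<chi> \<in> carrier_mat a b" "kron_list \<chi>s \<in> carrier_mat (a ^ length \<chi>s) (b ^ length \<chi>s)"
    by (auto intro!: kron_list_carrier)
  moreover have "kron_list (replicate (length \<chi>s) E) \<in> carrier_mat (b ^ length \<chi>s) (b ^ length \<chi>s)"
    using kron_list_carrier[of "replicate (length \<chi>s) E" b b] Cons.prems by (simp add: subset_iff)
  ultimately show ?case
    using Cons by (simp add: kron_transpose kron_mult[where e = b and f = "b ^ length \<chi>s"])
qed simp

lemma sqnorm_kron_list_replicate: "sqnorm (kron_list (replicate n A)) = sqnorm A ^ n"
  using sqnorm_one[of 1] by (induction n) (simp_all add: sqnorm_kron)

section \<open>Unmarkability\<close>

text \<open>Every ordering is a maximally entangled state, and after any number of rounds the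
  success probabilities over all orderings sum to at most \<open>sqnorm E ^ m\<close>; certainty
  would force this sum towards \<open>fact m\<close>. The intended \<open>E\<close> is the
  orthogonal projector onto Bob's common support, where \<open>sqnorm E\<close> is its rank.\<close>

lemma locally_unmarkable_if_fact_large:
  assumes "0 < a" and \<chi>: "set \<chi>s \<subseteq> carrier_mat a b" and E: "E \<in> carrier_mat b b"
    and coiso: "\<forall>\<chi> \<in> set \<chi>s. \<chi> * mat_adjoint \<chi> = 1\<^sub>m a"
    and supp: "\<forall>\<chi> \<in> set \<chi>s. \<chi> * transpose_mat E = \<chi>"
    and large: "sqnorm E ^ length \<chi>s < fact (length \<chi>s)"
  shows "locally_unmarkable a b \<chi>s"
proof
  assume "locally_markable a b \<chi>s"
  define m where "m = length \<chi>s"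
  obtain P where P: "valid_locc (a ^ m) (b ^ m) P"
    and cert: "\<And>\<pi>. \<pi> permutes {..<m} \<Longrightarrow> outputs_with_certainty \<pi> P (permuted_state \<chi>s \<pi>)"
    using \<open>locally_markable a b \<chi>s\<close> by (auto simp: locally_markable_def m_def)
  define R where "R = {\<pi>. \<pi> permutes {..<m}}"
  define X where "X = permuted_state \<chi>s"
  define B where "B = kron_list (replicate m E)"
  have R: "finite R" "card R = fact m"
    by (auto simp: R_def finite_permutations card_permutations)
  have B: "B \<in> carrier_mat (b ^ m) (b ^ m)"
    using kron_list_carrier[of "replicate m E" b b] E by (simp add: B_def subset_iff)
  have X: "X \<pi> \<in> carrier_mat (a ^ m) (b ^ m) \<and> X \<pi> * mat_adjoint (X \<pi>) = 1\<^sub>m (a ^ m) \<and>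
      X \<pi> * transpose_mat B = X \<pi>" if "\<pi> \<in> R" for \<pi>
  proof -
    define \<phi>s where "\<phi>s = map (\<lambda>k. \<chi>s ! \<pi> k) [0..<length \<chi>s]"
    \<comment> \<open>A permutation keeps positions in range, so the reordered list draws only on
      \<open>\<chi>s\<close> and inherits its three properties.\<close>
    have "\<pi> k < m" if "k < m" for k
      using \<open>\<pi> \<in> R\<close> that permutes_in_image[of \<pi> "{..<m}" k] by (simp add: R_def)
    then have "set \<phi>s \<subseteq> set \<chi>s" and len: "length \<phi>s = m"
      by (auto simp: \<phi>s_def m_def)
    then have "set \<phi>s \<subseteq> carrier_mat a b" "\<forall>\<chi> \<in> set \<phi>s. \<chi> * mat_adjoint \<chi> = 1\<^sub>m a"
      "\<forall>\<chi> \<in> set \<phi>s. \<chi> * transpose_mat E = \<chi>"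
      using \<chi> coiso supp by blast+
    moreover have "X \<pi> = kron_list \<phi>s"
      by (simp add: X_def permuted_state_def \<phi>s_def)
    ultimately show ?thesis
      using kron_list_carrier[of \<phi>s a b] kron_list_coisometry[of \<phi>s a b]
        kron_list_support[of \<phi>s a b E] E
      by (simp add: len B_def)
  qed
  \<comment> \<open>The coisometry lemma with the identity as left factor gives the normalization of
    every ordering.\<close>
  have norm: "sqnorm (X \<pi>) = a ^ m" if "\<pi> \<in> R" for \<pi>
    using sqnorm_mult_coisometry[of "1\<^sub>m (a ^ m)" "a ^ m" "a ^ m" "X \<pi>" "b ^ m"] X[OF that]
      sqnorm_one[of "a ^ m"] left_mult_one_mat[of "X \<pi>" "a ^ m" "b ^ m"] by simp
  have "(\<Sum>\<pi>\<in>R. output_prob n \<pi> P (X \<pi>)) \<le> sqnorm E ^ m" for n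
  proof -
    text \<open>
      Bob's initial operator is the projector onto the support rather than the identity: this
      replaces \<open>sqnorm (1\<^sub>m (b ^ m)) = b ^ m\<close> by \<open>sqnorm E ^ m\<close> in the bound.
    \<close>
    have "(\<Sum>\<pi>\<in>R. output_weight n \<pi> P (X \<pi>)) =
        (\<Sum>\<pi>\<in>R. output_weight n \<pi> P (1\<^sub>m (a ^ m) * X \<pi> * transpose_mat B))"
      using X by (intro sum.cong refl) (metis left_mult_one_mat)
    also have "\<dots> \<le> sqnorm (1\<^sub>m (a ^ m)) * sqnorm B"
      using X by (intro sum_output_weight_le[OF R(1) _ _ P _ B]) auto
    also have "\<dots> = real (a ^ m) * sqnorm E ^ m"
      unfolding sqnorm_one B_def sqnorm_kron_list_replicate ..
    \<comment> \<open>Alice's factor \<open>a ^ m\<close> is exactly the squared norm of each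
      \<open>X \<pi>\<close>, so it cancels on passing from weights to probabilities.\<close>
    finally have "(\<Sum>\<pi>\<in>R. output_weight n \<pi> P (X \<pi>)) / real (a ^ m) \<le> sqnorm E ^ m"
      using \<open>0 < a\<close> by (simp add: divide_le_eq mult.commute)
    then show ?thesis
      by (simp add: output_prob_def norm sum_divide_distrib)
  qed
  \<comment> \<open>Certainty is only a limit in the number of rounds; the bound is uniform in
    \<open>n\<close>, so it survives the limit.\<close>
  moreover have "(\<lambda>n. \<Sum>\<pi>\<in>R. output_prob n \<pi> P (X \<pi>)) \<longlonglongrightarrow> (\<Sum>\<pi>\<in>R. 1)"
    using cert by (intro tendsto_sum) (simp add: R_def X_def outputs_with_certainty_def)
  ultimately have "(\<Sum>\<pi>\<in>R. 1) \<le> sqnorm E ^ m"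
    by (intro LIMSEQ_le_const2) auto
  then show False
    using large R by (simp add: m_def)
qed

section \<open>Bob's projections and their effect on \<open>S1\<close>\<close>

definition coord_proj :: "nat set \<Rightarrow> complex mat" where
  "coord_proj J = mat 4 4 (\<lambda>(i, j). if i = j \<and> i \<in> J then 1 else 0)"

lemma coord_proj_carrier [simp]: "coord_proj J \<in> carrier_mat 4 4"
  by (simp add: coord_proj_def)

lemma dim_coord_proj [simp]: "dim_row (coord_proj J) = 4" "dim_col (coord_proj J) = 4"
  by (simp_all add: coord_proj_def)

lemma transpose_coord_proj [simp]: "transpose_mat (coord_proj J) = coord_proj J"
  by (rule eq_matI) (auto simp: coord_proj_def)

lemma mat_adjoint_coord_proj [simp]: "mat_adjoint (coord_proj J) = coord_proj J"
  by (rule eq_matI) (auto simp: coord_proj_def)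

lemma mult_coord_proj_index:
  assumes "A \<in> carrier_mat m 4" "i < m" "j < 4"
  shows "(A * coord_proj J) $$ (i, j) = (if j \<in> J then A $$ (i, j) else 0)"
proof -
  have "(A * coord_proj J) $$ (i, j) =
      (\<Sum>k<4. if k = j then (if j \<in> J then A $$ (i, j) else 0) else 0)"
    unfolding mult_mat_index[OF assms(1) coord_proj_carrier assms(2,3)]
    using assms(3) by (intro sum.cong refl) (auto simp: coord_proj_def)
  then show ?thesis
    using assms(3) by simp
qed

lemma coord_proj_mult: "coord_proj I * coord_proj J = coord_proj (I \<inter> J)"
  by (rule eq_matI)
    (simp_all add: mult_coord_proj_index[OF coord_proj_carrier] del: index_mult_mat(1),
      auto simp: coord_proj_def)

text \<open>The squared Frobenius norm of an orthogonal projector is its rank. Only the elements of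
  \<open>J\<close> below 4 index a level.\<close>

lemma sqnorm_coord_proj: "sqnorm (coord_proj J) = card (J \<inter> {..<4})"
proof -
  have "sqnorm (coord_proj J) = (\<Sum>i<4. \<Sum>j<4. if j = i then (if i \<in> J then 1 else 0) else 0)"
    unfolding sqnorm_carrier[OF coord_proj_carrier]
    by (intro sum.cong refl) (auto simp: coord_proj_def)
  then show ?thesis
    by (simp add: sum.If_cases Int_commute)
qed

text \<open>
  On either pair of Bob's levels the four states restrict to the four Bell states, up to signs and
  relabelling.
\<close>

lemma S1_proj_braket:
  assumes J: "J = {0, 1} \<or> J = {2, 3}" and "i < 4" "j < 4" "i \<noteq> j"
  shows "braket (S1 ! i * coord_proj J) (S1 ! j * coord_proj J) = 0"
proof -
  have two: "{..<2} = {0, 1::nat}" and four: "{..<4} = {0, 1, 2, 3::nat}"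
    by auto
  have S1: "S1 ! k \<in> carrier_mat 2 4" if "k < 4" for k
    using S1_carrier nth_mem[of k S1] that by (auto simp: S1_def)
  have "braket (S1 ! i * coord_proj J) (S1 ! j * coord_proj J) =
      (\<Sum>k<2. \<Sum>l<4. if l \<in> J then cnj ((S1 ! i) $$ (k, l)) * (S1 ! j) $$ (k, l) else 0)"
    unfolding braket_carrier[OF mult_carrier_mat[OF S1[OF assms(2)] coord_proj_carrier]]
    using S1[OF assms(2)] S1[OF assms(3)]
    by (intro sum.cong refl) (simp add: mult_coord_proj_index del: index_mult_mat)
  moreover have "i = 0 \<or> i = 1 \<or> i = 2 \<or> i = 3" "j = 0 \<or> j = 1 \<or> j = 2 \<or> j = 3"
    using assms by linarith+
  ultimately show ?thesis
    using J \<open>i \<noteq> j\<close> unfolding two four by (elim disjE) (simp_all add: S1_def)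
qed

text \<open>On each pair of levels every state becomes a signed 2-by-2 permutation matrix, which is
  unitary; padding it with zero columns keeps its rows orthonormal.\<close>

lemma S1_proj_coisometry:
  assumes J: "J = {0, 1} \<or> J = {2, 3}" and \<chi>: "\<chi> \<in> set S1"
  shows "(\<chi> * coord_proj J) * mat_adjoint (\<chi> * coord_proj J) = 1\<^sub>m 2"
proof (rule eq_matI)
  have four: "{..<4} = {0, 1, 2, 3::nat}"
    by auto
  have car: "\<chi> \<in> carrier_mat 2 4"
    using \<chi> S1_carrier by auto
  note P = mult_carrier_mat[OF car coord_proj_carrier]
  fix i j :: nat
  assume "i < dim_row (1\<^sub>m 2)" "j < dim_col (1\<^sub>m 2)"
  then have ij: "i < 2" "j < 2"
    by auto
  have "((\<chi> * coord_proj J) * mat_adjoint (\<chi> * coord_proj J)) $$ (i, j) =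
      (\<Sum>k<4. if k \<in> J then \<chi> $$ (i, k) * cnj (\<chi> $$ (j, k)) else 0)"
    unfolding mult_mat_index[OF P mat_adjoint_carrier[OF P] ij]
    using ij car P
    by (intro sum.cong refl) (simp add: mult_coord_proj_index[OF car] del: index_mult_mat(1))
  moreover have "i = 0 \<or> i = 1" "j = 0 \<or> j = 1"
    using ij by linarith+
  moreover have "\<chi> = \<psi>1 \<or> \<chi> = \<psi>2 \<or> \<chi> = \<psi>3 \<or> \<chi> = \<psi>4"
    using \<chi> by (simp add: S1_def)
  ultimately show "((\<chi> * coord_proj J) * mat_adjoint (\<chi> * coord_proj J)) $$ (i, j) = 1\<^sub>m 2 $$ (i, j)"
    using J unfolding four by (elim disjE) simp_all
qed (use \<chi> S1_carrier in auto)

theorem theorem3: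
  shows "deterministically_converted_via_local_OPM 2 4 S1 (locally_unmarkable 2 4)"
proof -
  \<comment> \<open>The operators are square, as \<open>local_OPM\<close> demands, so the outcomes
    stay in the 2-by-4 system. Bob's true support of dimension 2 enters later through the operator
    \<open>E\<close>.\<close>
  define Ms where "Ms = [coord_proj {0, 1}, coord_proj {2, 3}]"
  have complete: "kraus_complete 4 Ms"
    unfolding kraus_complete_def Ms_def
    by (rule eq_matI) (auto simp: coord_proj_mult, auto simp: coord_proj_def)
  have post: "post_states Bob (coord_proj J) S1 = map (\<lambda>\<chi>. \<chi> * coord_proj J) S1"
    if J: "J = {0, 1} \<or> J = {2, 3}" for J
  proof -
    \<comment> \<open>Each projected state has squared norm 2, so the filter in
      \<open>post_states\<close> drops nothing and four states remain.\<close>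
    have "\<chi> * coord_proj J \<noteq> 0\<^sub>m (dim_row (\<chi> * coord_proj J)) (dim_col (\<chi> * coord_proj J))"
      if "\<chi> \<in> set S1" for \<chi>
    proof
      assume zero: "\<chi> * coord_proj J = 0\<^sub>m (dim_row (\<chi> * coord_proj J)) (dim_col (\<chi> * coord_proj J))"
      have car: "\<chi> * coord_proj J \<in> carrier_mat 2 4"
        using that S1_carrier by auto
      have "sqnorm (\<chi> * coord_proj J) = sqnorm (1\<^sub>m 2)"
        using sqnorm_mult_coisometry[OF one_carrier_mat car S1_proj_coisometry[OF J that]]
        by (simp only: left_mult_one_mat[OF car])
      moreover have "sqnorm (\<chi> * coord_proj J) = 0"
        by (subst zero) (simp add: sqnorm_eq)
      ultimately show False
        by (simp add: sqnorm_one)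
    qed
    then show ?thesis
      by (simp add: post_states_def filter_id_conv)
  qed
  have len: "length S1 = 4"
    by (simp add: S1_def)
  have orth: "mutually_orthogonal (post_states Bob (coord_proj J) S1)"
    if J: "J = {0, 1} \<or> J = {2, 3}" for J
    unfolding post[OF J] mutually_orthogonal_def using S1_proj_braket[OF J] by (simp add: len)
  have unmark: "locally_unmarkable 2 4 (post_states Bob (coord_proj J) S1)"
    if J: "J = {0, 1} \<or> J = {2, 3}" for J
  proof (rule locally_unmarkable_if_fact_large[where E = "coord_proj J"])
    have car: "\<chi> * coord_proj J \<in> carrier_mat 2 4" if "\<chi> \<in> set S1" for \<chi>
      using that S1_carrier by auto
    then show "set (post_states Bob (coord_proj J) S1) \<subseteq> carrier_mat 2 4"
      by (auto simp: post[OF J])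
    show "\<forall>\<chi> \<in> set (post_states Bob (coord_proj J) S1). \<chi> * mat_adjoint \<chi> = 1\<^sub>m 2"
      using S1_proj_coisometry[OF J] by (simp add: post[OF J])
    show "\<forall>\<chi> \<in> set (post_states Bob (coord_proj J) S1). \<chi> * transpose_mat (coord_proj J) = \<chi>"
      using S1_carrier by (auto simp: post[OF J] coord_proj_mult assoc_mult_mat[of _ 2 4 _ 4 _ 4])
    \<comment> \<open>The rank 2 yields the decisive count
      \<open>2 ^ 4 = 16 < 24 = fact 4\<close>.\<close>
    have "card (J \<inter> {..<4}) = 2"
      using J by auto
    then show "sqnorm (coord_proj J) ^ length (post_states Bob (coord_proj J) S1)
        < fact (length (post_states Bob (coord_proj J) S1))"
      by (simp add: post[OF J] len sqnorm_coord_proj fact_numeral)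
  qed auto
  show ?thesis
    unfolding deterministically_converted_via_local_OPM_def local_OPM_def
    using complete orth unmark by (intro exI[of _ Bob] exI[of _ Ms]) (auto simp: Ms_def)
qed

end
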